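(* Let $\mathbf{A}$ be a category, $P$ a partial order and $G$ a group, such that, with data $0,F,\alpha,\beta,\beta'$, the conditions (A1)--(A6) listed in the context are satisfied. Then there is an equivalence of categories $\mathbf{A}\to P\rtimes G$ given by $x\mapsto\beta(x)$ on objects and $f\mapsto\alpha(F(f))$ on morphisms, where $P\rtimes G$ is formed with respect to the induced action of $G$ on $P$ described in the context.
   Context: **Conditions (A1)--(A6):** (A1) there is a weak initial object $0$ in $\mathbf{A}$ (every object $x$ admits a not necessarily unique morphism $0\to x$), unique up to isomorphism; (A2) there is a faithful functor $F:\mathbf{A}\to\mathbf{A}(0,0)$ that is a retraction (left inverse) of the inclusion $\mathbf{A}(0,0)\hookrightarrow\mathbf{A}$, where the endomorphism monoid $\mathbf{A}(0,0)$ is regarded as a one-object category; (A3) there is an isomorphism of monoids $\alpha:\mathbf{A}(0,0)\to G^{\mathrm{op}}$; (A4) there is an equivalence of preorders $\beta:(\mathbf{A},\le)\to P$, $\beta':P\to(\mathbf{A},\le)$, where the objects of $\mathbf{A}$ are preordered by $x\le y$ iff there is $f\in\mathbf{A}(x,y)$ with $F(f)=1$; (A5) for each object $x$ there is an isomorphism $f:x\to\beta'(\beta(x))$ with $\alpha(F(f))=1$; (A6) for each object $y$ and each $m\in G$ there is an isomorphism $f:x\to y$ (for some object $x$) with $\alpha(F(f))=m$. **Induced action.** $G$ acts on $P$ by order-preserving maps via $mp=\beta(x)$, where $f:x\to\beta'(p)$ is any isomorphism of $\mathbf{A}$ with $\alpha(F(f))=m$. **Grothendieck construction.** For a monoid $M$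 acting on a poset $P$, $P\rtimes M$ is the category whose objects are those of $P$, whose morphisms $p\to q$ are the $m\in M$ with $p\le mq$, and whose units and composition are inherited from $M^{\mathrm{op}}$ (the composite of $m:p\to q$ followed by $n:q\to r$ is $mn$). *)

theory Defs
  imports "HOL-Algebra.Group_Action"
begin

record ('o, 'a) cat =
  Obj :: "'o set"
  Arr :: "'a set"
  Dom :: "'a \<Rightarrow> 'o"
  Cod :: "'a \<Rightarrow> 'o"
  Id :: "'o \<Rightarrow> 'a"
  Comp :: "'a \<Rightarrow> 'a \<Rightarrow> 'a"  \<comment> \<open>\<open>Comp C g f\<close> is \<open>f\<close> followed by \<open>g\<close>\<close>

definition Hom :: "('o, 'a) cat \<Rightarrow> 'o \<Rightarrow> 'o \<Rightarrow> 'a set" where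
  "Hom C x y = {f \<in> Arr C. Dom C f = x \<and> Cod C f = y}"

locale category =
  fixes C :: "('o, 'a) cat"
  assumes dom_closed: "f \<in> Arr C \<Longrightarrow> Dom C f \<in> Obj C"
    and cod_closed: "f \<in> Arr C \<Longrightarrow> Cod C f \<in> Obj C"
    and id_closed: "x \<in> Obj C \<Longrightarrow> Id C x \<in> Hom C x x"
    and comp_closed: "f \<in> Hom C x y \<Longrightarrow> g \<in> Hom C y z \<Longrightarrow> Comp C g f \<in> Hom C x z"
    and id_left: "f \<in> Hom C x y \<Longrightarrow> Comp C (Id C y) f = f"
    and id_right: "f \<in> Hom C x y \<Longrightarrow> Comp C f (Id C x) = f"
    and comp_assoc: "f \<in> Hom C w x \<Longrightarrow> g \<in> Hom C x y \<Longrightarrow> h \<in> Hom C y z \<Longrightarrow>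
      Comp C h (Comp C g f) = Comp C (Comp C h g) f"

definition iso_arrow :: "('o, 'a) cat \<Rightarrow> 'o \<Rightarrow> 'o \<Rightarrow> 'a \<Rightarrow> bool" where
  "iso_arrow C x y f \<longleftrightarrow> x \<in> Obj C \<and> y \<in> Obj C \<and> f \<in> Hom C x y \<and>
     (\<exists>g\<in>Hom C y x. Comp C g f = Id C x \<and> Comp C f g = Id C y)"

definition isomorphic :: "('o, 'a) cat \<Rightarrow> 'o \<Rightarrow> 'o \<Rightarrow> bool" where
  "isomorphic C x y \<longleftrightarrow> (\<exists>f. iso_arrow C x y f)"

definition weak_initial :: "('o, 'a) cat \<Rightarrow> 'o \<Rightarrow> bool" where
  "weak_initial C z \<longleftrightarrow> z \<in> Obj C \<and> (\<forall>x\<in>Obj C. Hom C z x \<noteq> {})"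


subsection \<open>Functors and equivalences\<close>

locale cat_functor = source: category C + target: category D
  for C :: "('o, 'a) cat" and D :: "('p, 'b) cat" +
  fixes Fo :: "'o \<Rightarrow> 'p" and Fa :: "'a \<Rightarrow> 'b"
  assumes obj_closed: "x \<in> Obj C \<Longrightarrow> Fo x \<in> Obj D"
    and arr_closed: "f \<in> Hom C x y \<Longrightarrow> Fa f \<in> Hom D (Fo x) (Fo y)"
    and preserves_id: "x \<in> Obj C \<Longrightarrow> Fa (Id C x) = Id D (Fo x)"
    and preserves_comp: "f \<in> Hom C x y \<Longrightarrow> g \<in> Hom C y z \<Longrightarrow>
      Fa (Comp C g f) = Comp D (Fa g) (Fa f)"

definition faithful :: "('o, 'a) cat \<Rightarrow> ('a \<Rightarrow> 'b) \<Rightarrow> bool" where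
  "faithful C Fa \<longleftrightarrow> (\<forall>x\<in>Obj C. \<forall>y\<in>Obj C. inj_on Fa (Hom C x y))"

definition natural_iso ::
  "('o, 'a) cat \<Rightarrow> ('p, 'b) cat \<Rightarrow> ('o \<Rightarrow> 'p) \<Rightarrow> ('a \<Rightarrow> 'b) \<Rightarrow> ('o \<Rightarrow> 'p) \<Rightarrow> ('a \<Rightarrow> 'b)
    \<Rightarrow> ('o \<Rightarrow> 'b) \<Rightarrow> bool" where
  "natural_iso C D Fo Fa Ho Ha \<tau> \<longleftrightarrow>
     cat_functor C D Fo Fa \<and> cat_functor C D Ho Ha \<and>
     (\<forall>x\<in>Obj C. iso_arrow D (Fo x) (Ho x) (\<tau> x)) \<and>
     (\<forall>x y. \<forall>f\<in>Hom C x y. Comp D (\<tau> y) (Fa f) = Comp D (Ha f) (\<tau> x))"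

definition equivalence_of_categories ::
  "('o, 'a) cat \<Rightarrow> ('p, 'b) cat \<Rightarrow> ('o \<Rightarrow> 'p) \<Rightarrow> ('a \<Rightarrow> 'b) \<Rightarrow> bool" where
  "equivalence_of_categories C D Fo Fa \<longleftrightarrow>
     cat_functor C D Fo Fa \<and>
     (\<exists>Ko Ka. cat_functor D C Ko Ka \<and>
        (\<exists>\<eta>. natural_iso C C id id (Ko \<circ> Fo) (Ka \<circ> Fa) \<eta>) \<and>
        (\<exists>\<epsilon>. natural_iso D D (Fo \<circ> Ko) (Fa \<circ> Ka) id id \<epsilon>))"


subsection \<open>Endomorphism monoids and one-object categories\<close>

definition End_monoid :: "('o, 'a) cat \<Rightarrow> 'o \<Rightarrow> 'a monoid" where
  "End_monoid C x = \<lparr>carrier = Hom C x x, mult = Comp C, one = Id C x\<rparr>"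

definition op_monoid :: "('g, 'm) monoid_scheme \<Rightarrow> 'g monoid" where
  "op_monoid M = \<lparr>carrier = carrier M, mult = (\<lambda>a b. b \<otimes>\<^bsub>M\<^esub> a), one = \<one>\<^bsub>M\<^esub>\<rparr>"

definition one_object_cat :: "('g, 'm) monoid_scheme \<Rightarrow> (unit, 'g) cat" where
  "one_object_cat M = \<lparr>Obj = {()}, Arr = carrier M, Dom = (\<lambda>_. ()), Cod = (\<lambda>_. ()),
     Id = (\<lambda>_. \<one>\<^bsub>M\<^esub>), Comp = (\<otimes>\<^bsub>M\<^esub>)\<rparr>"

text \<open>
  A functor to \<^term>\<open>one_object_cat (End_monoid C z)\<close> is determined by its arrow map \<open>F\<close>.  The
  inclusion of that category into \<open>C\<close> sends the single object to \<open>z\<close> and is the identity on arrows.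
\<close>
definition faithful_retraction :: "('o, 'a) cat \<Rightarrow> 'o \<Rightarrow> ('a \<Rightarrow> 'a) \<Rightarrow> bool" where
  "faithful_retraction C z F \<longleftrightarrow>
     cat_functor C (one_object_cat (End_monoid C z)) (\<lambda>_. ()) F \<and>
     faithful C F \<and> (\<forall>f\<in>Hom C z z. F f = f)"


subsection \<open>Preorders\<close>

definition obj_preorder :: "('o, 'a) cat \<Rightarrow> 'o \<Rightarrow> ('a \<Rightarrow> 'a) \<Rightarrow> 'o rel" where
  "obj_preorder C z F =
     {(x, y). x \<in> Obj C \<and> y \<in> Obj C \<and> (\<exists>f\<in>Hom C x y. F f = Id C z)}"

definition preorder_equivalence ::
  "'x set \<Rightarrow> 'x rel \<Rightarrow> 'y set \<Rightarrow> 'y rel \<Rightarrow> ('x \<Rightarrow> 'y) \<Rightarrow> ('y \<Rightarrow> 'x) \<Rightarrow> bool" where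
  "preorder_equivalence X r Y s b b' \<longleftrightarrow>
     preorder_on X r \<and> preorder_on Y s \<and>
     b \<in> X \<rightarrow> Y \<and> monotone_on X (\<lambda>x y. (x, y) \<in> r) (\<lambda>x y. (x, y) \<in> s) b \<and>
     b' \<in> Y \<rightarrow> X \<and> monotone_on Y (\<lambda>x y. (x, y) \<in> s) (\<lambda>x y. (x, y) \<in> r) b' \<and>
     (\<forall>x\<in>X. (x, b' (b x)) \<in> r \<and> (b' (b x), x) \<in> r) \<and>
     (\<forall>y\<in>Y. (y, b (b' y)) \<in> s \<and> (b (b' y), y) \<in> s)"


subsection \<open>The induced action and the Grothendieck construction\<close>

text \<open>
  Under the conditions in which this is used, the described \<open>q\<close> exists and does not depend on the
  choice of \<open>x\<close> and \<open>f\<close>.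
  The restriction to \<open>P\<close> makes each map extensional, as \<^locale>\<open>group_action\<close> requires.
\<close>
definition induced_action ::
  "('o, 'a) cat \<Rightarrow> 'p set \<Rightarrow> ('a \<Rightarrow> 'a) \<Rightarrow> ('a \<Rightarrow> 'g) \<Rightarrow> ('o \<Rightarrow> 'p) \<Rightarrow> ('p \<Rightarrow> 'o)
    \<Rightarrow> 'g \<Rightarrow> 'p \<Rightarrow> 'p" where
  "induced_action C P F \<alpha> \<beta> \<beta>' m =
     (\<lambda>p\<in>P. THE q. \<exists>x f. iso_arrow C x (\<beta>' p) f \<and> \<alpha> (F f) = m \<and> q = \<beta> x)"

text \<open>
  Arrows are triples \<open>(p, m, q)\<close>, since the same \<open>m\<close> may be an arrow between different objects.
\<close>
definition grothendieck ::
  "'p set \<Rightarrow> 'p rel \<Rightarrow> ('g, 'm) monoid_scheme \<Rightarrow> ('g \<Rightarrow> 'p \<Rightarrow> 'p) \<Rightarrow> ('p, 'p \<times> 'g \<times> 'p) cat" where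
  "grothendieck P leP M act =
     \<lparr>Obj = P,
      Arr = {(p, m, q). p \<in> P \<and> q \<in> P \<and> m \<in> carrier M \<and> (p, act m q) \<in> leP},
      Dom = (\<lambda>(p, m, q). p),
      Cod = (\<lambda>(p, m, q). q),
      Id = (\<lambda>p. (p, \<one>\<^bsub>M\<^esub>, p)),
      Comp = (\<lambda>(q', n, r) (p, m, q). (p, m \<otimes>\<^bsub>M\<^esub> n, r))\<rparr>"

end

theory Submission
  imports Defs
begin

text \<open>
  Write \<open>deg f = \<alpha> (F f)\<close>.  By (A2) and (A3) this is a faithful, contravariant grading of the
  arrows of \<open>A\<close> by the group \<open>G\<close>: the degree of \<open>f\<close> followed by \<open>g\<close> is \<open>deg f \<otimes> deg g\<close>, and an
  arrow is determined by its end points and its degree.  By (A4), \<open>\<beta> x \<le> \<beta> y\<close> holds exactly when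
  there is an arrow \<open>x \<rightarrow> y\<close> of degree \<open>\<one>\<close>.

  The idea is that isomorphisms of arbitrary degree, supplied by (A6), reduce arrows of degree \<open>m\<close>
  to arrows of degree \<open>\<one>\<close>.  If \<open>g : w \<rightarrow> y\<close> is an isomorphism of degree \<open>m\<close>, then composing with
  \<open>g\<close> and its inverse matches the arrows \<open>x \<rightarrow> y\<close> of degree \<open>m\<close> with the arrows \<open>x \<rightarrow> w\<close> of
  degree \<open>\<one>\<close>, so one exists iff \<open>\<beta> x \<le> \<beta> w\<close> (\<open>deg_iso_iff\<close>).  By (A5) one may take \<open>y\<close> of the form
  \<open>\<beta>' p\<close> without changing degrees, so \<open>\<beta> w\<close> is \<open>m\<close> acting on \<open>\<beta> y\<close> (\<open>act_beta\<close>).  Hence the degrees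
  of the arrows \<open>x \<rightarrow> y\<close> are precisely the \<open>m\<close> with \<open>\<beta> x \<le> m (\<beta> y)\<close> (\<open>deg_iff_le_act\<close>), which are
  the arrows \<open>\<beta> x \<rightarrow> \<beta> y\<close> of the Grothendieck construction: the functor is fully faithful.  It is
  surjective on objects because \<open>P\<close> is antisymmetric, so that \<open>\<beta>'\<close> is a section of \<open>\<beta>\<close>, and such a functor is an equivalence
  (\<open>equivalence_if_fully_faithful_section\<close>).
\<close>

section \<open>Fully faithful functors with a section on objects\<close>

context category
begin

lemma Hom_objs: "f \<in> Hom C x y \<Longrightarrow> x \<in> Obj C \<and> y \<in> Obj C"
  using dom_closed cod_closed by (auto simp: Hom_def)

lemma iso_arrow_id: "x \<in> Obj C \<Longrightarrow> iso_arrow C x x (Id C x)"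
  unfolding iso_arrow_def using id_closed id_left by blast

lemma iso_arrow_comp:
  assumes "iso_arrow C x y f" "iso_arrow C y w g"
  shows "iso_arrow C x w (Comp C g f)"
proof -
  obtain f' where f': "f' \<in> Hom C y x" "Comp C f' f = Id C x" "Comp C f f' = Id C y"
    using assms by (auto simp: iso_arrow_def)
  obtain g' where g': "g' \<in> Hom C w y" "Comp C g' g = Id C y" "Comp C g g' = Id C w"
    using assms by (auto simp: iso_arrow_def)
  have f: "f \<in> Hom C x y" and g: "g \<in> Hom C y w"
    using assms by (auto simp: iso_arrow_def)
  have "Comp C (Comp C f' g') (Comp C g f) = Comp C f' (Comp C (Comp C g' g) f)"
    using comp_assoc[OF comp_closed[OF f g] g'(1) f'(1)] comp_assoc[OF f g g'(1)] by simp
  then have 1: "Comp C (Comp C f' g') (Comp C g f) = Id C x"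
    using f'(2) g'(2) id_left[OF f] by simp
  have "Comp C (Comp C g f) (Comp C f' g') = Comp C g (Comp C (Comp C f f') g')"
    using comp_assoc[OF comp_closed[OF g'(1) f'(1)] f g] comp_assoc[OF g'(1) f'(1) f] by simp
  then have 2: "Comp C (Comp C g f) (Comp C f' g') = Id C w"
    using f'(3) g'(3) id_left[OF g'(1)] by simp
  show ?thesis
    unfolding iso_arrow_def
    using 1 2 assms comp_closed[OF f g] comp_closed[OF g'(1) f'(1)] by (auto simp: iso_arrow_def)
qed

lemma cat_functor_id: "cat_functor C C id id"
  by unfold_locales auto

end

text \<open>
  Since \<open>Fo\<close> is strictly surjective on objects, no isomorphisms have to be chosen in \<open>D\<close>: the
  quasi-inverse sends an arrow to its unique preimage between the chosen objects, the
  counit is the identity and the unit at \<open>x\<close> is the preimage of the identity of \<open>Fo x\<close>.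
\<close>
lemma equivalence_if_fully_faithful_section:
  fixes C :: "('o, 'a) cat" and D :: "('p, 'b) cat"
  assumes "cat_functor C D Fo Fa"
    and bij: "\<And>x y. x \<in> Obj C \<Longrightarrow> y \<in> Obj C \<Longrightarrow>
      bij_betw Fa (Hom C x y) (Hom D (Fo x) (Fo y))"
    and sec: "\<And>d. d \<in> Obj D \<Longrightarrow> Ko d \<in> Obj C \<and> Fo (Ko d) = d"
  shows "equivalence_of_categories C D Fo Fa"
proof -
  interpret Fun: cat_functor C D Fo Fa by fact
  have unique: "f = f'" if "f \<in> Hom C x y" "f' \<in> Hom C x y" "Fa f = Fa f'" for f f' x y
  proof -
    have "x \<in> Obj C" "y \<in> Obj C" using Fun.source.Hom_objs[OF that(1)] by auto
    then have "inj_on Fa (Hom C x y)" by (rule bij_betw_imp_inj_on[OF bij])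
    then show ?thesis by (rule inj_onD[OF _ that(3,1,2)])
  qed
  define lift where "lift x y = inv_into (Hom C x y) Fa" for x y
  have lift: "lift x y g \<in> Hom C x y \<and> Fa (lift x y g) = g"
    if "x \<in> Obj C" "y \<in> Obj C" "g \<in> Hom D (Fo x) (Fo y)" for x y g
  proof -
    have g: "g \<in> Fa ` Hom C x y"
      using bij_betw_imp_surj_on[OF bij[OF that(1,2)]] that(3) by simp
    show ?thesis
      unfolding lift_def using inv_into_into[OF g] f_inv_into_f[OF g] by simp
  qed
  define Ka where "Ka g = lift (Ko (Dom D g)) (Ko (Cod D g)) g" for g
  have Ka: "Ka g \<in> Hom C (Ko d) (Ko e)" "Fa (Ka g) = g" if "g \<in> Hom D d e" for g d e
  proof -
    have "Dom D g = d" "Cod D g = e" using that by (auto simp: Hom_def)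
    moreover have "d \<in> Obj D" "e \<in> Obj D" using Fun.target.Hom_objs[OF that] by auto
    ultimately show "Ka g \<in> Hom C (Ko d) (Ko e)" "Fa (Ka g) = g"
      unfolding Ka_def using lift[of "Ko d" "Ko e" g] sec[of d] sec[of e] that by simp_all
  qed
  interpret K: cat_functor D C Ko Ka
  proof unfold_locales
    show "Ko x \<in> Obj C" if "x \<in> Obj D" for x using sec that by blast
    show "Ka f \<in> Hom C (Ko x) (Ko y)" if "f \<in> Hom D x y" for f x y using Ka that by blast
    show "Ka (Id D x) = Id C (Ko x)" if x: "x \<in> Obj D" for x
    proof (rule unique)
      note i = Fun.target.id_closed[OF x]
      show "Ka (Id D x) \<in> Hom C (Ko x) (Ko x)" by (rule Ka(1)[OF i])
      show "Id C (Ko x) \<in> Hom C (Ko x) (Ko x)"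
        using Fun.source.id_closed[of "Ko x"] sec[OF x] by simp
      show "Fa (Ka (Id D x)) = Fa (Id C (Ko x))"
        using Ka(2)[OF i] Fun.preserves_id[of "Ko x"] sec[OF x] by simp
    qed
    show "Ka (Comp D g f) = Comp C (Ka g) (Ka f)"
      if f: "f \<in> Hom D x y" and g: "g \<in> Hom D y w" for f g x y w
    proof (rule unique)
      note gf = Fun.target.comp_closed[OF f g]
      show "Ka (Comp D g f) \<in> Hom C (Ko x) (Ko w)" by (rule Ka(1)[OF gf])
      show "Comp C (Ka g) (Ka f) \<in> Hom C (Ko x) (Ko w)"
        by (rule Fun.source.comp_closed[OF Ka(1)[OF f] Ka(1)[OF g]])
      show "Fa (Ka (Comp D g f)) = Fa (Comp C (Ka g) (Ka f))"
        using Fun.preserves_comp[OF Ka(1)[OF f] Ka(1)[OF g]] Ka(2)[OF f] Ka(2)[OF g] Ka(2)[OF gf]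
        by simp
    qed
  qed
  have KF: "cat_functor C C (Ko \<circ> Fo) (Ka \<circ> Fa)"
    by unfold_locales
      (simp_all add: Fun.obj_closed K.obj_closed Fun.preserves_id K.preserves_id,
       blast intro: Fun.arr_closed K.arr_closed,
       metis Fun.arr_closed Fun.preserves_comp K.preserves_comp)
  have FK: "cat_functor D D (Fo \<circ> Ko) (Fa \<circ> Ka)"
    by unfold_locales
      (simp_all add: Fun.obj_closed K.obj_closed Fun.preserves_id K.preserves_id,
       blast intro: Fun.arr_closed K.arr_closed,
       metis K.arr_closed Fun.preserves_comp K.preserves_comp)
  define \<eta> where "\<eta> x = lift x (Ko (Fo x)) (Id D (Fo x))" for x
  define \<eta>' where "\<eta>' x = lift (Ko (Fo x)) x (Id D (Fo x))" for x
  have eta: "\<eta> x \<in> Hom C x (Ko (Fo x))" "Fa (\<eta> x) = Id D (Fo x)"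
    and eta': "\<eta>' x \<in> Hom C (Ko (Fo x)) x" "Fa (\<eta>' x) = Id D (Fo x)"
    and Fo_sec: "Ko (Fo x) \<in> Obj C" "Fo (Ko (Fo x)) = Fo x"
    and idF: "Comp D (Id D (Fo x)) (Id D (Fo x)) = Id D (Fo x)"
    if x: "x \<in> Obj C" for x
  proof -
    have F: "Fo x \<in> Obj D" by (rule Fun.obj_closed[OF x])
    have s: "Ko (Fo x) \<in> Obj C" "Fo (Ko (Fo x)) = Fo x" using sec[OF F] by auto
    have i: "Id D (Fo x) \<in> Hom D (Fo x) (Fo x)" by (rule Fun.target.id_closed[OF F])
    show "Ko (Fo x) \<in> Obj C" "Fo (Ko (Fo x)) = Fo x" by (rule s)+
    show "\<eta> x \<in> Hom C x (Ko (Fo x))" "Fa (\<eta> x) = Id D (Fo x)"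
      unfolding \<eta>_def using lift[OF x s(1)] s(2) i by simp_all
    show "\<eta>' x \<in> Hom C (Ko (Fo x)) x" "Fa (\<eta>' x) = Id D (Fo x)"
      unfolding \<eta>'_def using lift[OF s(1) x] s(2) i by simp_all
    show "Comp D (Id D (Fo x)) (Id D (Fo x)) = Id D (Fo x)"
      by (rule Fun.target.id_left[OF i])
  qed
  have unit: "natural_iso C C id id (Ko \<circ> Fo) (Ka \<circ> Fa) \<eta>"
    unfolding natural_iso_def
  proof (intro conjI ballI allI)
    show "cat_functor C C id id" by (rule Fun.source.cat_functor_id)
    show "cat_functor C C (Ko \<circ> Fo) (Ka \<circ> Fa)" by (rule KF)
  next
    fix x assume x: "x \<in> Obj C"
    have "Comp C (\<eta>' x) (\<eta> x) = Id C x"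
    proof (rule unique)
      show "Comp C (\<eta>' x) (\<eta> x) \<in> Hom C x x"
        by (rule Fun.source.comp_closed[OF eta(1)[OF x] eta'(1)[OF x]])
      show "Id C x \<in> Hom C x x" by (rule Fun.source.id_closed[OF x])
      show "Fa (Comp C (\<eta>' x) (\<eta> x)) = Fa (Id C x)"
        using Fun.preserves_comp[OF eta(1)[OF x] eta'(1)[OF x]]
        by (simp add: eta eta' idF Fun.preserves_id x)
    qed
    moreover have "Comp C (\<eta> x) (\<eta>' x) = Id C (Ko (Fo x))"
    proof (rule unique)
      show "Comp C (\<eta> x) (\<eta>' x) \<in> Hom C (Ko (Fo x)) (Ko (Fo x))"
        by (rule Fun.source.comp_closed[OF eta'(1)[OF x] eta(1)[OF x]])
      show "Id C (Ko (Fo x)) \<in> Hom C (Ko (Fo x)) (Ko (Fo x))"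
        by (rule Fun.source.id_closed[OF Fo_sec(1)[OF x]])
      show "Fa (Comp C (\<eta> x) (\<eta>' x)) = Fa (Id C (Ko (Fo x)))"
        using Fun.preserves_comp[OF eta'(1)[OF x] eta(1)[OF x]]
        by (simp add: eta eta' idF Fun.preserves_id Fo_sec x)
    qed
    ultimately show "iso_arrow C (id x) ((Ko \<circ> Fo) x) (\<eta> x)"
      using x eta(1)[OF x] eta'(1)[OF x] Fo_sec(1)[OF x] by (auto simp: iso_arrow_def)
  next
    fix x y f assume f: "f \<in> Hom C x y"
    have x: "x \<in> Obj C" and y: "y \<in> Obj C" using Fun.source.Hom_objs[OF f] by auto
    note Ff = Fun.arr_closed[OF f]
    show "Comp C (\<eta> y) (id f) = Comp C ((Ka \<circ> Fa) f) (\<eta> x)"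
    proof (rule unique)
      show "Comp C (\<eta> y) (id f) \<in> Hom C x (Ko (Fo y))"
        using Fun.source.comp_closed[OF f eta(1)[OF y]] by simp
      show "Comp C ((Ka \<circ> Fa) f) (\<eta> x) \<in> Hom C x (Ko (Fo y))"
        using Fun.source.comp_closed[OF eta(1)[OF x] Ka(1)[OF Ff]] by simp
      show "Fa (Comp C (\<eta> y) (id f)) = Fa (Comp C ((Ka \<circ> Fa) f) (\<eta> x))"
        using Fun.preserves_comp[OF f eta(1)[OF y]]
          Fun.preserves_comp[OF eta(1)[OF x] Ka(1)[OF Ff]]
          Fun.target.id_left[OF Ff] Fun.target.id_right[OF Ff] Ka(2)[OF Ff] eta(2) x y by simp
    qed
  qed
  have counit: "natural_iso D D (Fo \<circ> Ko) (Fa \<circ> Ka) id id (Id D)"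
    unfolding natural_iso_def
  proof (intro conjI ballI allI)
    show "cat_functor D D id id" by (rule Fun.target.cat_functor_id)
    show "cat_functor D D (Fo \<circ> Ko) (Fa \<circ> Ka)" by (rule FK)
    show "iso_arrow D ((Fo \<circ> Ko) d) (id d) (Id D d)" if "d \<in> Obj D" for d
      using Fun.target.iso_arrow_id sec that by simp
    show "Comp D (Id D e) ((Fa \<circ> Ka) g) = Comp D (id g) (Id D d)" if "g \<in> Hom D d e" for d e g
      using Ka(2)[OF that] Fun.target.id_left[OF that] Fun.target.id_right[OF that] by simp
  qed
  show ?thesis
    unfolding equivalence_of_categories_def
    using Fun.cat_functor_axioms K.cat_functor_axioms unit counit by blast
qed

section \<open>The Grothendieck construction of a monotone action\<close>

lemma Hom_grothendieck:
  "Hom (grothendieck P leP M act) p q =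
     {(p, m, q) | m. p \<in> P \<and> q \<in> P \<and> m \<in> carrier M \<and> (p, act m q) \<in> leP}"
  by (auto simp: Hom_def grothendieck_def)

lemma category_grothendieck:
  fixes M :: "('g, 'm) monoid_scheme" (structure)
  assumes "monoid M" and pre: "preorder_on P leP"
    and closed: "\<And>m p. m \<in> carrier M \<Longrightarrow> p \<in> P \<Longrightarrow> act m p \<in> P"
    and one: "\<And>p. p \<in> P \<Longrightarrow> act \<one> p = p"
    and mult: "\<And>m n p. m \<in> carrier M \<Longrightarrow> n \<in> carrier M \<Longrightarrow> p \<in> P \<Longrightarrow>
      act (m \<otimes> n) p = act m (act n p)"
    and mono: "\<And>m p q. m \<in> carrier M \<Longrightarrow> p \<in> P \<Longrightarrow> q \<in> P \<Longrightarrow> (p, q) \<in> leP \<Longrightarrow>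
      (act m p, act m q) \<in> leP"
  shows "category (grothendieck P leP M act)"
proof -
  interpret monoid M by fact
  have refl: "(p, p) \<in> leP" if "p \<in> P" for p
    using pre that by (auto simp: preorder_on_def refl_on_def)
  have trans: "(p, r) \<in> leP" if "(p, q) \<in> leP" "(q, r) \<in> leP" for p q r
    using pre that by (meson preorder_on_def transD)
  have comp: "(p, act (m \<otimes> n) r) \<in> leP"
    if "m \<in> carrier M" "n \<in> carrier M" "q \<in> P" "r \<in> P" "(p, act m q) \<in> leP" "(q, act n r) \<in> leP"
    for m n p q r
    using trans[OF that(5) mono[OF that(1,3) closed[OF that(2,4)] that(6)]]
    by (simp add: mult that)
  show ?thesis
    by unfold_locales
      (auto simp: Hom_grothendieck, auto simp: grothendieck_def one refl m_assoc intro: comp)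
qed

section \<open>Categories graded faithfully by a group\<close>

text \<open>
  The grading is contravariant, in accordance with the composition of a Grothendieck construction;
  it amounts to a faithful functor from \<open>A\<close> to the opposite of \<open>G\<close>.
\<close>
locale graded_category = category A + group G
  for A :: "('o, 'a) cat" and G :: "('g, 'm) monoid_scheme" (structure) +
  fixes deg :: "'a \<Rightarrow> 'g"
  assumes deg_closed: "f \<in> Hom A x y \<Longrightarrow> deg f \<in> carrier G"
    and deg_id: "x \<in> Obj A \<Longrightarrow> deg (Id A x) = \<one>"
    and deg_comp: "f \<in> Hom A x y \<Longrightarrow> g \<in> Hom A y w \<Longrightarrow> deg (Comp A g f) = deg f \<otimes> deg g"
    and deg_inj: "f \<in> Hom A x y \<Longrightarrow> f' \<in> Hom A x y \<Longrightarrow> deg f = deg f' \<Longrightarrow> f = f'"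
begin

lemma iso_arrow_HomD: "iso_arrow A x y f \<Longrightarrow> f \<in> Hom A x y"
  by (simp add: iso_arrow_def)

lemma deg_inverse_arrow:
  assumes "iso_arrow A x y f"
  obtains g where "g \<in> Hom A y x" "deg g = inv deg f"
proof -
  obtain g where g: "g \<in> Hom A y x" "Comp A g f = Id A x" and x: "x \<in> Obj A"
    using assms by (auto simp: iso_arrow_def)
  have f: "f \<in> Hom A x y" by (rule iso_arrow_HomD[OF assms])
  have "deg f \<otimes> deg g = \<one>"
    using deg_comp[OF f g(1)] g(2) deg_id[OF x] by simp
  then have "inv deg g = deg f"
    by (rule inv_equality[OF _ deg_closed[OF g(1)] deg_closed[OF f]])
  then have "deg g = inv deg f"
    using inv_inv[OF deg_closed[OF g(1)]] by simp
  with g(1) show thesis by (rule that)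
qed

end

text \<open>
  In terms of degrees, an equivalence of preorders onto a partial order becomes the two assumptions
  \<open>beta_le_iff\<close> and \<open>beta_section\<close>: antisymmetry turns the equivalence of \<open>\<beta> (\<beta>' p)\<close> and \<open>p\<close> into an
  equality.
\<close>
locale ordered_graded_category = graded_category A G deg
  for A :: "('o, 'a) cat" and G :: "('g, 'm) monoid_scheme" (structure) and deg :: "'a \<Rightarrow> 'g" +
  fixes P :: "'p set" and leP :: "'p rel" and \<beta> :: "'o \<Rightarrow> 'p" and \<beta>' :: "'p \<Rightarrow> 'o"
  assumes partial_order: "partial_order_on P leP"
    and beta_closed: "x \<in> Obj A \<Longrightarrow> \<beta> x \<in> P"
    and beta'_closed: "p \<in> P \<Longrightarrow> \<beta>' p \<in> Obj A"
    and beta_section: "p \<in> P \<Longrightarrow> \<beta> (\<beta>' p) = p"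
    and beta_le_iff: "x \<in> Obj A \<Longrightarrow> y \<in> Obj A \<Longrightarrow>
      (\<beta> x, \<beta> y) \<in> leP \<longleftrightarrow> (\<exists>f\<in>Hom A x y. deg f = \<one>)"
    and iso_to_section: "x \<in> Obj A \<Longrightarrow> \<exists>f. iso_arrow A x (\<beta>' (\<beta> x)) f \<and> deg f = \<one>"
    and iso_of_degree: "y \<in> Obj A \<Longrightarrow> m \<in> carrier G \<Longrightarrow> \<exists>x f. iso_arrow A x y f \<and> deg f = m"
begin

abbreviation act :: "'g \<Rightarrow> 'p \<Rightarrow> 'p" where
  "act \<equiv> induced_action A P id deg \<beta> \<beta>'"

text \<open>
  Composition with \<open>g\<close> multiplies degrees on the right by \<open>deg g\<close>, composition with its inverse by
  \<open>inv deg g\<close>; these exchange the degrees \<open>\<one>\<close> and \<open>deg g\<close>.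
\<close>
lemma deg_iso_iff:
  assumes x: "x \<in> Obj A" and g: "iso_arrow A w y g"
  shows "(\<exists>f\<in>Hom A x y. deg f = deg g) \<longleftrightarrow> (\<beta> x, \<beta> w) \<in> leP"
proof -
  have gH: "g \<in> Hom A w y" by (rule iso_arrow_HomD[OF g])
  have w: "w \<in> Obj A" using Hom_objs[OF gH] by blast
  obtain g' where g': "g' \<in> Hom A y w" "deg g' = inv deg g"
    by (rule deg_inverse_arrow[OF g])
  have "\<exists>h\<in>Hom A x w. deg h = \<one>" if f: "f \<in> Hom A x y" "deg f = deg g" for f
  proof (rule bexI)
    show "deg (Comp A g' f) = \<one>"
      using deg_comp[OF f(1) g'(1)] f(2) g'(2) deg_closed[OF gH] by simp
  qed (rule comp_closed[OF f(1) g'(1)])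
  moreover have "\<exists>f\<in>Hom A x y. deg f = deg g" if h: "h \<in> Hom A x w" "deg h = \<one>" for h
  proof (rule bexI)
    show "deg (Comp A g h) = deg g"
      using deg_comp[OF h(1) gH] h(2) deg_closed[OF gH] by simp
  qed (rule comp_closed[OF h(1) gH])
  ultimately show ?thesis using beta_le_iff[OF x w] by blast
qed

section \<open>The induced action\<close>

text \<open>
  Each of two isomorphisms with the same target and degree is an arrow of that degree into the
  target of the other, so their sources lie below each other.
\<close>
lemma beta_source_unique:
  assumes f: "iso_arrow A x y f" and g: "iso_arrow A w y g" and eq: "deg f = deg g"
  shows "\<beta> x = \<beta> w"
proof -
  have "x \<in> Obj A" "w \<in> Obj A" using f g by (auto simp: iso_arrow_def)
  then have "(\<beta> x, \<beta> w) \<in> leP" "(\<beta> w, \<beta> x) \<in> leP"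
    using deg_iso_iff[OF _ g, of x] deg_iso_iff[OF _ f, of w] eq
      iso_arrow_HomD[OF f] iso_arrow_HomD[OF g] by auto
  moreover have "antisym leP"
    using partial_order by (simp add: partial_order_on_def)
  ultimately show ?thesis by (rule antisymD[rotated 1])
qed

lemma act_section:
  assumes p: "p \<in> P" and f: "iso_arrow A x (\<beta>' p) f"
  shows "act (deg f) p = \<beta> x"
proof -
  have "(THE q. \<exists>x' f'. iso_arrow A x' (\<beta>' p) f' \<and> deg (id f') = deg f \<and> q = \<beta> x') = \<beta> x"
  proof (rule the_equality)
    show "\<exists>x' f'. iso_arrow A x' (\<beta>' p) f' \<and> deg (id f') = deg f \<and> \<beta> x = \<beta> x'"
      using f unfolding id_apply by blast
    show "q = \<beta> x" if "\<exists>x' f'. iso_arrow A x' (\<beta>' p) f' \<and> deg (id f') = deg f \<and> q = \<beta> x'" for q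
      using that beta_source_unique[OF _ f] unfolding id_apply by blast
  qed
  then show ?thesis using p by (simp add: induced_action_def)
qed

lemma act_beta:
  assumes g: "iso_arrow A w y g"
  shows "act (deg g) (\<beta> y) = \<beta> w"
proof -
  have y: "y \<in> Obj A" using g by (simp add: iso_arrow_def)
  obtain i where i: "iso_arrow A y (\<beta>' (\<beta> y)) i" "deg i = \<one>"
    using iso_to_section[OF y] by blast
  have "deg (Comp A i g) = deg g"
    using deg_comp[OF iso_arrow_HomD[OF g] iso_arrow_HomD[OF i(1)]] i(2)
      deg_closed[OF iso_arrow_HomD[OF g]] by simp
  then show ?thesis
    using act_section[OF beta_closed[OF y] iso_arrow_comp[OF g i(1)]] by simp
qed

text \<open>
  This identifies the arrows of \<open>A\<close> with those of the Grothendieck construction.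
\<close>
lemma deg_iff_le_act:
  assumes x: "x \<in> Obj A" and y: "y \<in> Obj A" and m: "m \<in> carrier G"
  shows "(\<exists>f\<in>Hom A x y. deg f = m) \<longleftrightarrow> (\<beta> x, act m (\<beta> y)) \<in> leP"
proof -
  obtain w g where g: "iso_arrow A w y g" "deg g = m"
    using iso_of_degree[OF y m] by blast
  show ?thesis using deg_iso_iff[OF x g(1)] act_beta[OF g(1)] g(2) by simp
qed

lemma act_witness:
  assumes "p \<in> P" "m \<in> carrier G"
  obtains x f where "iso_arrow A x (\<beta>' p) f" "x \<in> Obj A" "deg f = m" "act m p = \<beta> x"
proof -
  obtain x f where "iso_arrow A x (\<beta>' p) f" "deg f = m"
    using iso_of_degree[OF beta'_closed] assms by blast
  then show thesis
    using that[of x f] act_section[OF assms(1)] by (auto simp: iso_arrow_def)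
qed

lemma act_closed:
  assumes m: "m \<in> carrier G" and p: "p \<in> P" shows "act m p \<in> P"
proof (rule act_witness[OF p m])
  fix x assume "x \<in> Obj A" "act m p = \<beta> x"
  then show ?thesis using beta_closed by metis
qed

lemma act_one:
  assumes p: "p \<in> P" shows "act \<one> p = p"
  using act_section[OF p iso_arrow_id[OF beta'_closed[OF p]]] deg_id[OF beta'_closed[OF p]]
    beta_section[OF p] by simp

lemma act_mult:
  assumes m: "m \<in> carrier G" and n: "n \<in> carrier G" and p: "p \<in> P"
  shows "act (m \<otimes> n) p = act m (act n p)"
proof -
  obtain x f where f: "iso_arrow A x (\<beta>' p) f" "x \<in> Obj A" "deg f = n" "act n p = \<beta> x"
    by (rule act_witness[OF p n])
  obtain w g where g: "iso_arrow A w x g" "deg g = m"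
    using iso_of_degree[OF f(2) m] by blast
  have "deg (Comp A f g) = m \<otimes> n"
    using deg_comp[OF iso_arrow_HomD[OF g(1)] iso_arrow_HomD[OF f(1)]] f(3) g(2) by simp
  then show ?thesis
    using act_section[OF p iso_arrow_comp[OF g(1) f(1)]] act_beta[OF g(1)] f(4) g(2) by simp
qed

lemma act_mono:
  assumes m: "m \<in> carrier G" and p: "p \<in> P" and q: "q \<in> P" and le: "(p, q) \<in> leP"
  shows "(act m p, act m q) \<in> leP"
proof -
  obtain x f where f: "iso_arrow A x (\<beta>' p) f" "x \<in> Obj A" "deg f = m" "act m p = \<beta> x"
    by (rule act_witness[OF p m])
  obtain h where h: "h \<in> Hom A (\<beta>' p) (\<beta>' q)" "deg h = \<one>"
    using beta_le_iff[OF beta'_closed[OF p] beta'_closed[OF q]] beta_section p q le by auto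
  have "Comp A h f \<in> Hom A x (\<beta>' q)" "deg (Comp A h f) = m"
    using comp_closed[OF iso_arrow_HomD[OF f(1)] h(1)]
      deg_comp[OF iso_arrow_HomD[OF f(1)] h(1)] f(3) h(2) m by auto
  then show ?thesis
    using deg_iff_le_act[OF f(2) beta'_closed[OF q] m] beta_section[OF q] f(4) by auto
qed

lemma group_action_act: "group_action G P act"
proof -
  have inverse: "act (inv m) (act m p) = p" "act m (act (inv m) p) = p"
    if "m \<in> carrier G" "p \<in> P" for m p
    using that act_mult[of "inv m" m p] act_mult[of m "inv m" p] act_one by simp_all
  have Bij: "act m \<in> Bij P" if m: "m \<in> carrier G" for m
  proof -
    have "bij_betw (act m) P P"
      by (rule bij_betw_byWitness[where f' = "act (inv m)"])
        (use inverse act_closed m in auto)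
    then show ?thesis by (simp add: Bij_def induced_action_def)
  qed
  have "act (m \<otimes> n) = act m \<otimes>\<^bsub>BijGroup P\<^esub> act n"
    if mn: "m \<in> carrier G" "n \<in> carrier G" for m n
  proof -
    have "act (m \<otimes> n) = compose P (act m) (act n)"
    proof
      fix p show "act (m \<otimes> n) p = compose P (act m) (act n) p"
        by (cases "p \<in> P") (use act_mult mn in \<open>simp_all add: compose_def induced_action_def\<close>)
    qed
    then show ?thesis using Bij mn by (simp add: BijGroup_def)
  qed
  then have "act \<in> hom G (BijGroup P)"
    using Bij by (auto simp: hom_def BijGroup_def)
  then show ?thesis
    unfolding group_action_def group_hom_def group_hom_axioms_def
    using group_BijGroup is_group by blast
qed

section \<open>The equivalence with the Grothendieck construction\<close>

lemma equivalence_grothendieck: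
  "equivalence_of_categories A (grothendieck P leP G act)
     \<beta> (\<lambda>f. (\<beta> (Dom A f), deg f, \<beta> (Cod A f)))"
  (is "equivalence_of_categories A ?D \<beta> ?Fa")
proof (rule equivalence_if_fully_faithful_section[where Ko = \<beta>'])
  have pre: "preorder_on P leP"
    using partial_order by (simp add: partial_order_on_def)
  interpret D: category ?D
    by (rule category_grothendieck)
      (use pre act_closed act_one act_mult act_mono monoid_axioms in auto)
  have Fa: "?Fa f = (\<beta> x, deg f, \<beta> y)" if "f \<in> Hom A x y" for f x y
    using that by (simp add: Hom_def)
  have Fa_Hom: "?Fa f \<in> Hom ?D (\<beta> x) (\<beta> y)" if f: "f \<in> Hom A x y" for f x y
  proof -
    have "x \<in> Obj A" "y \<in> Obj A" using Hom_objs[OF f] by auto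
    then show ?thesis
      using Fa[OF f] deg_closed[OF f] deg_iff_le_act[of x y "deg f"] f beta_closed
      by (auto simp: Hom_grothendieck)
  qed
  show "cat_functor A ?D \<beta> ?Fa"
  proof unfold_locales
    show "\<beta> x \<in> Obj ?D" if "x \<in> Obj A" for x
      using beta_closed[OF that] by (simp add: grothendieck_def)
    show "?Fa f \<in> Hom ?D (\<beta> x) (\<beta> y)" if "f \<in> Hom A x y" for f x y
      by (rule Fa_Hom[OF that])
    show "?Fa (Id A x) = Id ?D (\<beta> x)" if "x \<in> Obj A" for x
      using Fa[OF id_closed[OF that]] deg_id[OF that] by (simp add: grothendieck_def)
    show "?Fa (Comp A g f) = Comp ?D (?Fa g) (?Fa f)"
      if "f \<in> Hom A x y" "g \<in> Hom A y w" for f g x y w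
      using Fa[OF that(1)] Fa[OF that(2)] Fa[OF comp_closed[OF that]] deg_comp[OF that]
      by (simp add: grothendieck_def)
  qed
  show "bij_betw ?Fa (Hom A x y) (Hom ?D (\<beta> x) (\<beta> y))"
    if x: "x \<in> Obj A" and y: "y \<in> Obj A" for x y
  proof (rule bij_betwI')
    show "?Fa f = ?Fa g \<longleftrightarrow> f = g" if "f \<in> Hom A x y" "g \<in> Hom A x y" for f g
      using Fa[OF that(1)] Fa[OF that(2)] deg_inj[OF that] by auto
    show "?Fa f \<in> Hom ?D (\<beta> x) (\<beta> y)" if "f \<in> Hom A x y" for f
      by (rule Fa_Hom[OF that])
    show "\<exists>f\<in>Hom A x y. t = ?Fa f" if t: "t \<in> Hom ?D (\<beta> x) (\<beta> y)" for t
    proof -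
      obtain m where m: "t = (\<beta> x, m, \<beta> y)" "m \<in> carrier G" "(\<beta> x, act m (\<beta> y)) \<in> leP"
        using t by (auto simp: Hom_grothendieck)
      then obtain f where "f \<in> Hom A x y" "deg f = m"
        using deg_iff_le_act[OF x y m(2)] by blast
      then show ?thesis using Fa m(1) by auto
    qed
  qed
  show "\<beta>' d \<in> Obj A \<and> \<beta> (\<beta>' d) = d" if "d \<in> Obj ?D" for d
    using that beta'_closed beta_section by (simp add: grothendieck_def)
qed

end

section \<open>From the conditions to the grading\<close>

lemma graded_category_retraction:
  fixes A :: "('o, 'a) cat" and G :: "('g, 'm) monoid_scheme"
  assumes "category A" and "group G" and z: "z \<in> Obj A"
    and ret: "faithful_retraction A z F"
    and iso: "\<alpha> \<in> iso (End_monoid A z) (op_monoid G)"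
  shows "graded_category A G (\<lambda>f. \<alpha> (F f))"
proof -
  interpret A: category A by fact
  interpret G: group G by fact
  interpret R: cat_functor A "one_object_cat (End_monoid A z)" "\<lambda>_. ()" F
    using ret by (simp add: faithful_retraction_def)
  have F_closed: "F f \<in> Hom A z z" if "f \<in> Hom A x y" for f x y
    using R.arr_closed[OF that] by (simp add: Hom_def one_object_cat_def End_monoid_def)
  have F_comp: "F (Comp A g f) = Comp A (F g) (F f)"
    if "f \<in> Hom A x y" "g \<in> Hom A y w" for f g x y w
    using R.preserves_comp[OF that] by (simp add: one_object_cat_def End_monoid_def)
  have F_id: "F (Id A x) = Id A z" if "x \<in> Obj A" for x
    using R.preserves_id[OF that] by (simp add: one_object_cat_def End_monoid_def)
  have \<alpha>_closed: "\<alpha> f \<in> carrier G" if "f \<in> Hom A z z" for f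
    using iso that by (auto simp: iso_def hom_def End_monoid_def op_monoid_def)
  have \<alpha>_comp: "\<alpha> (Comp A g f) = \<alpha> f \<otimes>\<^bsub>G\<^esub> \<alpha> g" if "f \<in> Hom A z z" "g \<in> Hom A z z" for f g
    using iso that by (auto simp: iso_def hom_def End_monoid_def op_monoid_def)
  have \<alpha>_inj: "inj_on \<alpha> (Hom A z z)"
    using iso by (auto simp: iso_def bij_betw_def End_monoid_def)
  have idz: "Id A z \<in> Hom A z z" by (rule A.id_closed[OF z])
  \<comment> \<open>In a group, the only idempotent is the unit.\<close>
  have \<alpha>_id: "\<alpha> (Id A z) = \<one>\<^bsub>G\<^esub>"
    using \<alpha>_comp[OF idz idz] A.id_left[OF idz] \<alpha>_closed[OF idz] G.r_cancel_one' by metis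
  show ?thesis
  proof (unfold_locales, goal_cases)
    case (1 f x y) then show ?case using \<alpha>_closed F_closed by blast
  next
    case (2 x) then show ?case using F_id \<alpha>_id by simp
  next
    case (3 f x y g w) then show ?case using F_comp \<alpha>_comp F_closed by metis
  next
    case (4 f x y f')
    then have "F f = F f'" using \<alpha>_inj F_closed by (metis inj_onD)
    then show ?case
      using ret 4(1,2) A.Hom_objs[OF 4(1)] unfolding faithful_retraction_def faithful_def
      by (metis inj_onD)
  qed
qed

lemma preorder_equivalence_iff:
  assumes eq: "preorder_equivalence X r Y s b b'" and x: "x \<in> X" and y: "y \<in> X"
  shows "(b x, b y) \<in> s \<longleftrightarrow> (x, y) \<in> r"
proof
  assume "(x, y) \<in> r"
  then show "(b x, b y) \<in> s"
    using eq x y by (auto simp: preorder_equivalence_def monotone_on_def)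
next
  assume le: "(b x, b y) \<in> s"
  have "b x \<in> Y" "b y \<in> Y"
    using eq x y by (auto simp: preorder_equivalence_def)
  then have "(b' (b x), b' (b y)) \<in> r"
    using eq le by (simp add: preorder_equivalence_def monotone_on_def)
  moreover have "(x, b' (b x)) \<in> r" "(b' (b y), y) \<in> r" "trans r"
    using eq x y by (simp_all add: preorder_equivalence_def preorder_on_def)
  ultimately show "(x, y) \<in> r" by (meson transD)
qed

theorem theorem3p7:
  fixes A :: "('o, 'a) cat"
    and P :: "'p set" and leP :: "'p rel"
    and G :: "('g, 'm) monoid_scheme"
    and z :: 'o and F :: "'a \<Rightarrow> 'a" and \<alpha> :: "'a \<Rightarrow> 'g"
    and \<beta> :: "'o \<Rightarrow> 'p" and \<beta>' :: "'p \<Rightarrow> 'o"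
  assumes "category A"
    and "partial_order_on P leP"
    and "group G"
    and A1: "weak_initial A z" "\<forall>z'. weak_initial A z' \<longrightarrow> isomorphic A z' z"
    and A2: "faithful_retraction A z F"
    and A3: "\<alpha> \<in> iso (End_monoid A z) (op_monoid G)"
    and A4: "preorder_equivalence (Obj A) (obj_preorder A z F) P leP \<beta> \<beta>'"
    and A5: "\<forall>x\<in>Obj A. \<exists>f. iso_arrow A x (\<beta>' (\<beta> x)) f \<and> \<alpha> (F f) = \<one>\<^bsub>G\<^esub>"
    and A6: "\<forall>y\<in>Obj A. \<forall>m\<in>carrier G. \<exists>x f. iso_arrow A x y f \<and> \<alpha> (F f) = m"
  shows
    \<comment> \<open>the induced action is well defined and is an action by order-preserving maps\<close>
    "let act = induced_action A P F \<alpha> \<beta> \<beta>' in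
     (\<forall>p\<in>P. \<forall>x f. iso_arrow A x (\<beta>' p) f \<longrightarrow> act (\<alpha> (F f)) p = \<beta> x) \<and>
     group_action G P act \<and>
     (\<forall>m\<in>carrier G. monotone_on P (\<lambda>p q. (p, q) \<in> leP) (\<lambda>p q. (p, q) \<in> leP) (act m)) \<and>
     equivalence_of_categories A (grothendieck P leP G act)
       \<beta> (\<lambda>f. (\<beta> (Dom A f), \<alpha> (F f), \<beta> (Cod A f)))"
proof -
  define deg where "deg = (\<lambda>f. \<alpha> (F f))"
  have z: "z \<in> Obj A" using A1(1) by (simp add: weak_initial_def)
  interpret graded_category A G deg
    unfolding deg_def by (rule graded_category_retraction[OF assms(1,3) z A2 A3])
  have F_eq_id: "F f = Id A z \<longleftrightarrow> deg f = \<one>\<^bsub>G\<^esub>" if f: "f \<in> Hom A x y" for f x y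
  proof -
    have retract: "F h = h" if "h \<in> Hom A z z" for h
      using A2 that by (simp add: faithful_retraction_def)
    interpret R: cat_functor A "one_object_cat (End_monoid A z)" "\<lambda>_. ()" F
      using A2 by (simp add: faithful_retraction_def)
    have Ff: "F f \<in> Hom A z z"
      using R.arr_closed[OF f] by (simp add: Hom_def one_object_cat_def End_monoid_def)
    \<comment> \<open>Since \<open>F\<close> is a retraction, \<open>f\<close> and \<open>F f\<close> have the same degree.\<close>
    have "deg (F f) = deg f" by (simp add: deg_def retract[OF Ff])
    then show ?thesis
      using deg_inj[OF Ff id_closed[OF z]] deg_id[OF z] by auto
  qed
  interpret ordered_graded_category A G deg P leP \<beta> \<beta>'
  proof (unfold_locales, goal_cases)
    case 1 show ?case by (rule assms(2))
  next
    case (2 x) then show ?case using A4 by (auto simp: preorder_equivalence_def)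
  next
    case (3 p) then show ?case using A4 by (auto simp: preorder_equivalence_def)
  next
    case (4 p)
    moreover have "antisym leP" using assms(2) by (simp add: partial_order_on_def)
    ultimately show ?case
      using A4 by (auto simp: preorder_equivalence_def dest: antisymD)
  next
    case (5 x y)
    then show ?case
      using preorder_equivalence_iff[OF A4 5] F_eq_id by (auto simp: obj_preorder_def)
  next
    case (6 x) then show ?case using A5 by (simp add: deg_def)
  next
    case (7 y m) then show ?case using A6 by (simp add: deg_def)
  qed
  have act: "induced_action A P F \<alpha> \<beta> \<beta>' = act"
    by (simp add: induced_action_def deg_def fun_eq_iff)
  have "\<forall>p\<in>P. \<forall>x f. iso_arrow A x (\<beta>' p) f \<longrightarrow> act (\<alpha> (F f)) p = \<beta> x"
    using act_section by (simp add: deg_def)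
  moreover have "\<forall>m\<in>carrier G.
      monotone_on P (\<lambda>p q. (p, q) \<in> leP) (\<lambda>p q. (p, q) \<in> leP) (act m)"
    using act_mono by (simp add: monotone_on_def)
  moreover have "equivalence_of_categories A (grothendieck P leP G act)
      \<beta> (\<lambda>f. (\<beta> (Dom A f), \<alpha> (F f), \<beta> (Cod A f)))"
    using equivalence_grothendieck by (simp add: deg_def)
  ultimately show ?thesis
    unfolding Let_def act using group_action_act by blast
qed

end
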